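(* For any connected graph $G$, $$\rho_1(G)-\rho_2(G)\ <\ \min_{u\in V(G)}\sqrt{\sum_{v\in V(G)}d_{uv}^2}\,,$$ where $d_{uv}$ denotes the distance between $u$ and $v$ in $G$.
   Context: All graphs are finite, undirected, simple and connected; $V(G)$ is the vertex set of $G$. The distance matrix $\mathcal{D}(G)$ of a graph $G$ on vertices $1,\dots,n$ is the $n\times n$ matrix whose $(i,j)$ entry is the length $d_{ij}$ of a shortest path from $i$ to $j$. A real number $\lambda$ is a Pareto eigenvalue of a real $n\times n$ matrix $A$ if there is a nonzero vector $\mathbf{x}\in\mathbb{R}^n$, $\mathbf{x}\ge 0$ (entrywise), with $A\mathbf{x}\ge\lambda\mathbf{x}$ (entrywise) and $\lambda=\frac{\mathbf{x}^TA\mathbf{x}}{\mathbf{x}^T\mathbf{x}}$. The distance Pareto eigenvalues of $G$ are the Pareto eigenvalues of $\mathcal{D}(G)$. $\rho_k(G)$ denotes the $k$-th largest element of the set of distinct distance Pareto eigenvalues of $G$.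
   Formalization: The graph is assumed to have at least three vertices: for a single vertex the second largest distance Pareto eigenvalue does not exist, and for two vertices both sides equal 1, so the strict inequality fails. *)

theory Defs
  imports "HOL-Analysis.Analysis" "Graph_Theory.Graph_Theory"
begin

text \<open>Paths are repetition-free lists of arcs. The value is meaningful only if some path from
  \<open>u\<close> to \<open>v\<close> exists, as it does in a connected graph.\<close>
definition graph_dist :: "'a pair_pre_digraph \<Rightarrow> 'a \<Rightarrow> 'a \<Rightarrow> nat" where
  "graph_dist G u v = (LEAST k. \<exists>p. pre_digraph.apath (with_proj G) u p v \<and> length p = k)"

text \<open>The vertices index the rows and columns, so this is intended for \<open>pverts G = UNIV\<close>.\<close>
definition distance_matrix :: "'n::finite pair_pre_digraph \<Rightarrow> real^'n^'n" where
  "distance_matrix G = (\<chi> i j. real (graph_dist G i j))"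

text \<open>The order on \<open>real^'n\<close> is the entrywise one.\<close>
definition pareto_eigenvalue :: "real^'n^'n \<Rightarrow> real \<Rightarrow> bool" where
  "pareto_eigenvalue A l \<longleftrightarrow>
     (\<exists>x::real^'n. x \<noteq> 0 \<and> 0 \<le> x \<and> l *\<^sub>R x \<le> A *v x \<and> l = (x \<bullet> (A *v x)) / (x \<bullet> x))"

definition distance_pareto_eigenvalues :: "'n::finite pair_pre_digraph \<Rightarrow> real set" where
  "distance_pareto_eigenvalues G = {l. pareto_eigenvalue (distance_matrix G) l}"

text \<open>The \<open>k\<close>-th largest element of a set \<open>S\<close> is the one that has exactly \<open>k\<close> elements of \<open>S\<close>
  greater than or equal to it (itself included). Here \<open>k\<close> starts from 1, and the value is
  meaningful only if such an element exists.\<close>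
definition kth_largest :: "nat \<Rightarrow> 'a::linorder set \<Rightarrow> 'a" where
  "kth_largest k S = (THE l. l \<in> S \<and> card {m \<in> S. l \<le> m} = k)"

text \<open>The two largest values need at least two vertices to exist. With exactly two vertices the
  distance Pareto eigenvalues are 0 and 1, so the gap \<open>rho 1 - rho 2 = 1\<close> equals the Euclidean
  norm of either row of the distance matrix; a strict bound of the gap by such a norm therefore
  needs at least three vertices.\<close>
definition distance_pareto_rho :: "nat \<Rightarrow> 'n::finite pair_pre_digraph \<Rightarrow> real" where
  "distance_pareto_rho k G = kth_largest k (distance_pareto_eigenvalues G)"

end

theory Submission
  imports Defs
begin

text \<open>
  The largest distance Pareto eigenvalue \<open>r\<close> is the maximal Rayleigh quotient of the distance
  matrix \<open>A\<close>, and for each vertex \<open>u\<close> the maximum \<open>b\<close> of the Rayleigh quotient over the vectors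
  vanishing at \<open>u\<close> is a smaller Pareto eigenvalue, so that the second largest is at least \<open>b\<close>.
  Split a unit Perron vector as \<open>x = y + s e\<^sub>u\<close> with \<open>y\<close> vanishing at \<open>u\<close>, and let \<open>c\<close> be the column
  of \<open>A\<close> at \<open>u\<close>. As the diagonal of \<open>A\<close> is zero,
  \<open>r = y \<bullet> A y + 2 s (y \<bullet> c) \<le> b |y|\<^sup>2 + 2 s |y| |c| < b + |c|\<close>, because \<open>|y|\<^sup>2 + s\<^sup>2 = 1\<close>, \<open>s > 0\<close>, and
  \<open>b > 0\<close> when there are at least three vertices.
\<close>

section \<open>The \<open>k\<close>-th largest element of a set\<close>

lemma kth_largest_eqI:
  fixes S :: "'a::linorder set"
  assumes "l \<in> S" and "card {m \<in> S. l \<le> m} = k" and "k > 0"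
  shows "kth_largest k S = l"
proof -
  have less: False if "a \<in> S" "card {m \<in> S. a \<le> m} = k" "card {m \<in> S. b \<le> m} = k" "a < b" for a b
  proof -
    \<comment> \<open>\<open>card\<close> of an infinite set is 0, which \<open>k > 0\<close>
      excludes.\<close>
    have "finite {m \<in> S. a \<le> m}"
      using that(2) assms(3) by (metis card.infinite less_irrefl)
    moreover have "{m \<in> S. b \<le> m} \<subset> {m \<in> S. a \<le> m}"
    proof
      show "{m \<in> S. b \<le> m} \<subseteq> {m \<in> S. a \<le> m}" using \<open>a < b\<close> by auto
      have "a \<in> {m \<in> S. a \<le> m}" "a \<notin> {m \<in> S. b \<le> m}" using that(1,4) by auto
      then show "{m \<in> S. b \<le> m} \<noteq> {m \<in> S. a \<le> m}" by blast
    qed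
    ultimately show False
      using psubset_card_mono that(2,3) by (metis less_irrefl)
  qed
  show ?thesis
    unfolding kth_largest_def
  proof (rule the_equality)
    show "l \<in> S \<and> card {m \<in> S. l \<le> m} = k" using assms by simp
    show "a = l" if "a \<in> S \<and> card {m \<in> S. a \<le> m} = k" for a
      using less[of a l] less[of l a] that assms(1,2) by (cases a l rule: linorder_cases) auto
  qed
qed

lemma kth_largest_1:
  fixes S :: "'a::linorder set"
  assumes "finite S" and "S \<noteq> {}"
  shows "kth_largest 1 S = Max S"
proof (rule kth_largest_eqI)
  have "{m \<in> S. Max S \<le> m} = {Max S}"
    using Max_in[OF assms] Max_ge[OF assms(1)] by (auto intro: antisym)
  then show "card {m \<in> S. Max S \<le> m} = 1" by simp
qed (use Max_in[OF assms] in auto)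

text \<open>Having \<open>b\<close> above it, \<open>a\<close> survives the removal of the maximum,
  and the maximum of what is left is the second largest element.\<close>

lemma kth_largest_2_ge:
  fixes S :: "'a::linorder set"
  assumes "finite S" and "a \<in> S" and "b \<in> S" and "a < b"
  shows "a \<le> kth_largest 2 S"
proof -
  let ?M = "Max S" and ?N = "Max (S - {Max S})"
  have a: "a \<in> S - {?M}" using assms(2,4) Max_ge[OF assms(1,3)] by (auto dest: leD)
  then have N: "?N \<in> S - {?M}" using assms(1) by (intro Max_in) auto
  have le: "m \<le> ?N" if "m \<in> S - {?M}" for m
    using that assms(1) by simp
  have "?N \<le> ?M" using N assms(1) by simp
  have "m = ?M \<or> m = ?N" if "m \<in> S" "?N \<le> m" for m
    using le[of m] that by fastforce
  moreover have "?M \<in> S" using assms by (intro Max_in) auto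
  ultimately have "{m \<in> S. ?N \<le> m} = {?M, ?N}"
    using N \<open>?N \<le> ?M\<close> by blast
  moreover have "?M \<noteq> ?N" using N by (metis Diff_iff singletonI)
  ultimately have "card {m \<in> S. ?N \<le> m} = 2" by simp
  then have "kth_largest 2 S = ?N" using N by (intro kth_largest_eqI) auto
  then show ?thesis using le[OF a] by simp
qed

section \<open>Rayleigh quotients and Pareto eigenvalues of symmetric matrices\<close>

lemma inner_symmetric_matrix:
  fixes A :: "real^'n^'n"
  assumes "transpose A = A"
  shows "x \<bullet> (A *v y) = y \<bullet> (A *v x)"
  by (metis assms dot_lmul_matrix inner_commute transpose_matrix_vector)

text \<open>The unit sphere of \<open>W\<close> is compact, and homogeneity of degree two carries
  the bound from it to all of \<open>W\<close>.\<close>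

lemma rayleigh_max_exists:
  fixes A :: "real^'n^'n"
  assumes W: "subspace W" and "w \<in> W" and "w \<noteq> 0"
  obtains x where "x \<in> W" and "norm x = 1" and "\<And>y. y \<in> W \<Longrightarrow> y \<bullet> (A *v y) \<le> (x \<bullet> (A *v x)) * (y \<bullet> y)"
proof -
  have "compact (W \<inter> sphere 0 1)"
    by (intro closed_Int_compact closed_subspace W compact_sphere)
  moreover have "w /\<^sub>R norm w \<in> W \<inter> sphere 0 1"
    using assms by (auto intro: subspace_scale)
  moreover have "continuous_on (W \<inter> sphere 0 1) (\<lambda>x. x \<bullet> (A *v x))"
    by (intro continuous_intros linear_continuous_on_compose[where g="(*v) A"]) auto
  ultimately obtain x where x: "x \<in> W \<inter> sphere 0 1"
    and max: "\<And>y. y \<in> W \<inter> sphere 0 1 \<Longrightarrow> y \<bullet> (A *v y) \<le> x \<bullet> (A *v x)"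
    using continuous_attains_sup[of "W \<inter> sphere 0 1" "\<lambda>x. x \<bullet> (A *v x)"] by blast
  have "y \<bullet> (A *v y) \<le> (x \<bullet> (A *v x)) * (y \<bullet> y)" if "y \<in> W" for y
  proof (cases "y = 0")
    case False
    let ?y = "y /\<^sub>R norm y"
    have "?y \<in> W \<inter> sphere 0 1" using that False W by (auto intro: subspace_scale)
    then have "?y \<bullet> (A *v ?y) \<le> x \<bullet> (A *v x)" by (rule max)
    moreover have "?y \<bullet> (A *v ?y) = (y \<bullet> (A *v y)) / (y \<bullet> y)"
      by (simp add: matrix_vector_mult_scaleR dot_square_norm power2_eq_square field_simps)
    ultimately show ?thesis using False by (simp add: divide_le_eq)
  qed simp
  with x that show thesis by auto
qed

text \<open>First-order condition at a maximum: perturbing \<open>x\<close> to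
  \<open>x + t *\<^sub>R z\<close> gives an inequality quadratic in \<open>t\<close>, whose linear
  coefficient must vanish.\<close>

lemma rayleigh_max_stationary:
  fixes A :: "real^'n^'n"
  assumes sym: "transpose A = A" and W: "subspace W" and x: "x \<in> W" and z: "z \<in> W"
    and r: "x \<bullet> (A *v x) = r * (x \<bullet> x)"
    and max: "\<And>y. y \<in> W \<Longrightarrow> y \<bullet> (A *v y) \<le> r * (y \<bullet> y)"
  shows "z \<bullet> (A *v x) = r * (z \<bullet> x)"
proof -
  define b where "b = z \<bullet> (A *v x) - r * (z \<bullet> x)"
  define c where "c = r * (z \<bullet> z) - z \<bullet> (A *v z)"
  have t: "2 * b * t \<le> c * t\<^sup>2" for t
  proof -
    have "x + t *\<^sub>R z \<in> W" using x z W by (simp add: subspace_add subspace_scale)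
    from max[OF this] show ?thesis
      using r inner_symmetric_matrix[OF sym, of x z]
      by (simp add: b_def c_def matrix_vector_right_distrib matrix_vector_mult_scaleR
          inner_add_left inner_add_right inner_commute power2_eq_square algebra_simps)
  qed
  have "c \<ge> 0" using max[OF z] by (simp add: c_def)
  have "b = 0"
  proof (rule ccontr)
    assume "b \<noteq> 0"
    \<comment> \<open>A small step in the direction of the sign of \<open>b\<close> violates
      \<open>t\<close>; the denominator \<open>c + 1\<close> stays positive even if
      \<open>c = 0\<close>.\<close>
    define d where "d = b / (c + 1)"
    have bd: "b = d * (c + 1)" using \<open>c \<ge> 0\<close> by (simp add: d_def)
    have "d\<^sup>2 * (c + 2) \<le> 0" using t[of d] by (simp add: bd power2_eq_square algebra_simps)
    moreover have "d\<^sup>2 * (c + 2) > 0" using \<open>b \<noteq> 0\<close> \<open>c \<ge> 0\<close> by (simp add: bd)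
    ultimately show False by simp
  qed
  then show ?thesis by (simp add: b_def)
qed

definition supp :: "real^'n \<Rightarrow> 'n set" where
  "supp x = {i. x $ i \<noteq> 0}"

lemma subspace_supp: "subspace {z. supp z \<subseteq> S}"
  unfolding subspace_def supp_def subset_iff by (auto, metis add_0)

lemma nonneg_matrix_mult_nonneg:
  fixes A :: "real^'n^'m"
  assumes "0 \<le> A" and "0 \<le> x"
  shows "0 \<le> A *v x"
  using assms by (auto simp: less_eq_vec_def matrix_vector_mult_def intro!: sum_nonneg mult_nonneg_nonneg)

text \<open>Entrywise absolute values keep support and norm and, as \<open>A\<close> is nonnegative,
  do not lower the quadratic form, so some maximiser is nonnegative. Stationarity gives the
  eigenvalue equation on \<open>S\<close>; where \<open>x\<close> vanishes, the Pareto inequality is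
  just nonnegativity of \<open>A *v x\<close>.\<close>

lemma rayleigh_max_on_coordinates:
  fixes A :: "real^'n^'n"
  assumes sym: "transpose A = A" and nonneg: "0 \<le> A" and "S \<noteq> {}"
  obtains x r where "supp x \<subseteq> S" and "norm x = 1" and "0 \<le> x" and "x \<bullet> (A *v x) = r"
    and "\<And>y. supp y \<subseteq> S \<Longrightarrow> y \<bullet> (A *v y) \<le> r * (y \<bullet> y)"
    and "\<And>i. i \<in> S \<Longrightarrow> (A *v x) $ i = r * x $ i"
    and "pareto_eigenvalue A r"
proof -
  let ?W = "{z. supp z \<subseteq> S}"
  obtain s where "s \<in> S" using \<open>S \<noteq> {}\<close> by blast
  then have "axis s (1::real) \<in> ?W" by (auto simp: supp_def axis_def)
  then obtain w where w: "w \<in> ?W" "norm w = 1"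
    and max: "\<And>y. y \<in> ?W \<Longrightarrow> y \<bullet> (A *v y) \<le> (w \<bullet> (A *v w)) * (y \<bullet> y)"
    using rayleigh_max_exists[OF subspace_supp] by (metis axis_eq_0_iff zero_neq_one)
  define r where "r = w \<bullet> (A *v w)"
  define x where "x = (\<chi> i. \<bar>w $ i\<bar>)"
  have xW: "x \<in> ?W" using w(1) by (auto simp: x_def supp_def)
  have nx: "norm x = 1" using w(2) by (simp add: x_def norm_vec_def)
  have "w \<bullet> (A *v w) \<le> x \<bullet> (A *v x)"
    unfolding inner_vec_def matrix_vector_mult_def x_def
  proof (simp add: sum_distrib_left, intro sum_mono)
    fix i j
    have "w $ i * (A $ i $ j * w $ j) \<le> \<bar>w $ i * (A $ i $ j * w $ j)\<bar>" by simp
    also have "\<dots> = \<bar>w $ i\<bar> * (A $ i $ j * \<bar>w $ j\<bar>)"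
      using nonneg by (simp add: abs_mult less_eq_vec_def)
    finally show "w $ i * (A $ i $ j * w $ j) \<le> \<bar>w $ i\<bar> * (A $ i $ j * \<bar>w $ j\<bar>)" .
  qed
  moreover have xx: "x \<bullet> x = 1" using nx by (simp add: dot_square_norm)
  ultimately have xr: "x \<bullet> (A *v x) = r"
    using max[OF xW] by (simp add: r_def)
  have eig: "(A *v x) $ i = r * x $ i" if "i \<in> S" for i
  proof -
    have "axis i (1::real) \<in> ?W" using that by (auto simp: supp_def axis_def)
    then have "axis i 1 \<bullet> (A *v x) = r * (axis i 1 \<bullet> x)"
      by (rule rayleigh_max_stationary[OF sym subspace_supp xW])
        (use xr xx max in \<open>auto simp: r_def\<close>)
    then show ?thesis by (simp add: inner_axis')
  qed
  have x0: "0 \<le> x" by (simp add: x_def less_eq_vec_def)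
  have "r *\<^sub>R x \<le> A *v x"
    unfolding less_eq_vec_def
  proof
    fix i
    show "(r *\<^sub>R x) $ i \<le> (A *v x) $ i"
      using eig[of i] nonneg_matrix_mult_nonneg[OF nonneg x0] xW
      by (cases "x $ i = 0") (auto simp: less_eq_vec_def supp_def)
  qed
  moreover have "x \<noteq> 0" using nx by auto
  ultimately have "pareto_eigenvalue A r"
    unfolding pareto_eigenvalue_def using x0 xr xx by (intro exI[of _ x]) auto
  then show thesis using that[of x r] xW nx x0 xr max eig by (auto simp: r_def)
qed

text \<open>For nonnegative eigenvectors \<open>x\<close>, \<open>y\<close> of \<open>l\<close>, \<open>m\<close> with equal support, \<open>x \<bullet> (A *v y)\<close> is both
  \<open>l * (x \<bullet> y)\<close> and \<open>m * (x \<bullet> y)\<close>, where \<open>x \<bullet> y > 0\<close>,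
  so a Pareto eigenvalue is determined by the support of its eigenvector.\<close>
lemma finite_pareto_eigenvalues:
  fixes A :: "real^'n^'n"
  assumes sym: "transpose A = A"
  shows "finite {l. pareto_eigenvalue A l}"
proof -
  define P where "P l x \<longleftrightarrow> x \<noteq> 0 \<and> 0 \<le> x \<and> l *\<^sub>R x \<le> A *v x \<and> l = (x \<bullet> (A *v x)) / (x \<bullet> x)"
    for l and x :: "real^'n"
  \<comment> \<open>Complementary slackness: nonnegative terms with sum 0 all vanish, so
    \<open>A *v x\<close> and \<open>l *\<^sub>R x\<close> agree on the support of
    \<open>x\<close>.\<close>
  have compl: "y \<bullet> (A *v x) = l * (y \<bullet> x)" if "P l x" and "supp y \<subseteq> supp x" for l x y
  proof -
    have d: "0 \<le> x $ i * ((A *v x) $ i - l * x $ i)" for i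
      using that(1) by (auto simp: P_def less_eq_vec_def intro!: mult_nonneg_nonneg)
    have "x \<bullet> (A *v x) = l * (x \<bullet> x)" using that(1) by (auto simp: P_def)
    then have "(\<Sum>i\<in>UNIV. x $ i * ((A *v x) $ i - l * x $ i)) = 0"
      by (simp add: inner_vec_def right_diff_distrib sum_subtractf sum_distrib_left mult_ac)
    then have "x $ i * ((A *v x) $ i - l * x $ i) = 0" for i
      using d by (simp add: sum_nonneg_eq_0_iff)
    then have "y $ i * (A *v x) $ i = l * (y $ i * x $ i)" for i
      using that(2) by (cases "x $ i = 0") (auto simp: supp_def)
    then show ?thesis by (simp only: inner_vec_def inner_real_def sum_distrib_left)
  qed
  have unique: "l = m" if "P l x" "P m y" "supp x = supp y" for l m x y
  proof -
    have "m * (x \<bullet> y) = l * (x \<bullet> y)"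
      using compl[OF that(1), of y] compl[OF that(2), of x] that(3) inner_symmetric_matrix[OF sym, of x y]
      by (metis inner_commute order_refl)
    moreover have "x \<bullet> y > 0"
    proof -
      have "x \<noteq> 0" using that(1) by (simp add: P_def)
      then obtain i where "x $ i \<noteq> 0" by (metis vec_eq_iff zero_index)
      moreover from this have "y $ i \<noteq> 0" using that(3) by (auto simp: supp_def)
      moreover have nn: "0 \<le> x $ j" "0 \<le> y $ j" for j using that(1,2) by (auto simp: P_def less_eq_vec_def)
      ultimately have "0 < x $ i * y $ i" by (metis less_eq_real_def mult_pos_pos)
      then show ?thesis unfolding inner_vec_def
        using nn by (intro sum_pos2[where i=i]) auto
    qed
    ultimately show ?thesis by simp
  qed
  define f where "f l = supp (SOME x. P l x)" for l
  have "P l (SOME x. P l x)" if "pareto_eigenvalue A l" for l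
    using that unfolding pareto_eigenvalue_def P_def by (rule someI_ex)
  then have "inj_on f {l. pareto_eigenvalue A l}"
    using unique unfolding inj_on_def f_def by (metis mem_Collect_eq)
  then show ?thesis by (rule inj_on_finite[of _ _ UNIV]) auto
qed

section \<open>The gap bound for matrices\<close>

lemma pareto_gap_less_column_norm:
  fixes A :: "real^'n^'n"
  assumes sym: "transpose A = A" and diag: "\<And>i. A $ i $ i = 0"
    and pos: "\<And>i j. i \<noteq> j \<Longrightarrow> A $ i $ j > 0" and card: "CARD('n) \<ge> 3"
  shows "kth_largest 1 {l. pareto_eigenvalue A l} - kth_largest 2 {l. pareto_eigenvalue A l}
    < norm (column u A)"
proof -
  let ?P = "{l. pareto_eigenvalue A l}" and ?c = "column u A"
  have nonneg: "0 \<le> A"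
    unfolding less_eq_vec_def using diag pos by (metis less_eq_real_def zero_index)
  have fin: "finite ?P" by (rule finite_pareto_eigenvalues[OF sym])
  \<comment> \<open>Row \<open>u\<close> is positive off the diagonal. This serves twice: to
    separate \<open>b\<close> from \<open>r\<close>, and to show that the Perron vector is positive
    at \<open>u\<close>.\<close>
  have zero_entry: "x $ v = 0" if "(A *v x) $ u = 0" "0 \<le> x" "v \<noteq> u" for x v
  proof -
    have "(\<Sum>j\<in>UNIV. A $ u $ j * x $ j) = 0" using that(1) by (simp add: matrix_vector_mult_def)
    then have "A $ u $ v * x $ v = 0"
      using nonneg that(2) by (subst (asm) sum_nonneg_eq_0_iff) (auto simp: less_eq_vec_def)
    then show ?thesis using pos[of u v] that(3) by simp
  qed
  obtain x r where x: "norm x = 1" "0 \<le> x" "x \<bullet> (A *v x) = r"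
    and rmax: "\<And>y. y \<bullet> (A *v y) \<le> r * (y \<bullet> y)"
    and xeig: "\<And>i. (A *v x) $ i = r * x $ i" and rP: "r \<in> ?P"
    using rayleigh_max_on_coordinates[OF sym nonneg, of UNIV] by auto
  have "card (UNIV - {u}) \<ge> 2" using card by simp
  then obtain T where T: "T \<subseteq> UNIV - {u}" "card T = 2"
    by (metis obtain_subset_with_card_n)
  then obtain v w where "T = {v, w}" "v \<noteq> w" by (auto simp: card_2_iff)
  then have vw: "v \<noteq> u" "w \<noteq> u" "v \<noteq> w" and ne: "UNIV - {u} \<noteq> {}" using T by auto
  obtain z b where z: "supp z \<subseteq> UNIV - {u}" "norm z = 1" "0 \<le> z" "z \<bullet> (A *v z) = b"
    and bmax: "\<And>y. supp y \<subseteq> UNIV - {u} \<Longrightarrow> y \<bullet> (A *v y) \<le> b * (y \<bullet> y)"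
    and bP: "b \<in> ?P"
    using rayleigh_max_on_coordinates[OF sym nonneg ne] by (metis mem_Collect_eq)
  have zz: "z \<bullet> z = 1" and xx: "x \<bullet> x = 1" using z(2) x(1) by (simp_all add: dot_square_norm)
  have zu: "z $ u = 0" using z(1) by (auto simp: supp_def)
  have "b \<noteq> r"
  proof
    assume "b = r"
    \<comment> \<open>If \<open>b = r\<close>, then \<open>z\<close> maximises over the whole space,
      so the eigenvalue equation also holds at \<open>u\<close>, where \<open>z\<close>
      vanishes.\<close>
    have "axis u 1 \<bullet> (A *v z) = r * (axis u 1 \<bullet> z)"
      by (rule rayleigh_max_stationary[OF sym subspace_UNIV]) (use z(4) zz rmax \<open>b = r\<close> in auto)
    then have "(A *v z) $ u = 0" using zu by (simp add: inner_axis')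
    then have "z = 0" using zero_entry z(3) zu by (metis vec_eq_iff zero_index)
    then show False using z(2) by simp
  qed
  moreover have "b \<le> r" using rmax[of z] z(4) zz by simp
  ultimately have br: "b < r" by simp
  have top: "kth_largest 1 ?P = r"
  proof -
    have "l \<le> r" if "pareto_eigenvalue A l" for l
    proof -
      obtain y where "y \<noteq> 0" "l = (y \<bullet> (A *v y)) / (y \<bullet> y)"
        using \<open>pareto_eigenvalue A l\<close> unfolding pareto_eigenvalue_def by blast
      then show ?thesis using rmax[of y] by (simp add: divide_le_eq)
    qed
    then have "Max ?P = r" using fin rP by (intro Max_eqI) auto
    then show ?thesis using kth_largest_1 fin rP by blast
  qed
  have second: "b \<le> kth_largest 2 ?P" by (rule kth_largest_2_ge[OF fin bP rP br])
  have b0: "b > 0"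
  proof -
    \<comment> \<open>A test vector on two vertices other than \<open>u\<close>; this is where the
      third vertex enters.\<close>
    let ?y = "axis v 1 + axis w 1 :: real^'n"
    have "?y \<bullet> (A *v ?y) = A $ v $ w + A $ w $ v"
      using diag by (simp add: matrix_vector_right_distrib matrix_vector_mult_basis inner_add_left
          inner_axis' column_def)
    then have "?y \<bullet> (A *v ?y) > 0" using pos[of v w] pos[of w v] vw(3) by simp
    moreover have "supp ?y \<subseteq> UNIV - {u}" using vw by (auto simp: supp_def axis_def)
    ultimately have "b * (?y \<bullet> ?y) > 0" using bmax[of ?y] by linarith
    then show ?thesis by (metis inner_ge_zero mult_nonpos_nonneg not_less)
  qed
  have xu: "x $ u > 0"
  proof (rule ccontr)
    assume "\<not> x $ u > 0"
    then have "x $ u = 0" using x(2) by (simp add: less_eq_vec_def order_antisym)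
    then have "x = 0" using zero_entry[of x] x(2) xeig[of u]
      by (metis mult_zero_right vec_eq_iff zero_index)
    then show False using x(1) by simp
  qed
  define s where "s = x $ u"
  define y where "y = x - s *\<^sub>R axis u 1"
  have x_eq: "x = y + s *\<^sub>R axis u 1" by (simp add: y_def)
  have yu: "y $ u = 0" by (simp add: y_def s_def)
  have norm_split: "1 = (norm y)\<^sup>2 + s\<^sup>2"
    using xx unfolding x_eq power2_norm_eq_inner
    by (simp add: inner_add_left inner_add_right inner_axis inner_axis' yu power2_eq_square)
  have "r = y \<bullet> (A *v y) + 2 * s * (y \<bullet> ?c)"
  proof -
    have "axis u 1 \<bullet> (A *v axis u 1) = 0"
      using diag by (simp add: matrix_vector_mult_basis inner_axis' column_def)
    then show ?thesis
      using x(3) inner_symmetric_matrix[OF sym, of "axis u 1" y] unfolding x_eq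
      by (simp add: matrix_vector_right_distrib matrix_vector_mult_scaleR inner_add_left
          inner_add_right matrix_vector_mult_basis)
  qed
  also have "\<dots> \<le> b * (norm y)\<^sup>2 + 2 * s * (norm y * norm ?c)"
  proof (intro add_mono mult_left_mono norm_cauchy_schwarz)
    have "supp y \<subseteq> UNIV - {u}" using yu by (auto simp: supp_def)
    then show "y \<bullet> (A *v y) \<le> b * (norm y)\<^sup>2" using bmax[of y] by (simp add: dot_square_norm)
  qed (use xu in \<open>simp add: s_def\<close>)
  also have "\<dots> < b + norm ?c"
  \<comment> \<open>Strictness comes from the first summand alone; the second is bounded by
    \<open>2 * s * norm y \<le> s\<^sup>2 + (norm y)\<^sup>2\<close>.\<close>
  proof (rule add_less_le_mono)
    have "s\<^sup>2 > 0" using xu by (simp add: s_def)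
    then have "(norm y)\<^sup>2 < 1" using norm_split by linarith
    then show "b * (norm y)\<^sup>2 < b" using b0 by simp
    have "2 * s * norm y \<le> 1"
      using norm_split sum_squares_bound[of s "norm y"] by simp
    then show "2 * s * (norm y * norm ?c) \<le> norm ?c"
      using mult_right_mono[of "2 * s * norm y" 1 "norm ?c"] by (simp add: mult_ac)
  qed
  finally show ?thesis using top second by simp
qed

section \<open>Graph distances and the theorem\<close>

lemma (in pair_sym_digraph) graph_dist_commute: "graph_dist G u v = graph_dist G v u"
proof -
  have len: "length (rev_path p) = length p" for p :: "('a \<times> 'a) list"
    by (induct p) auto
  have "(\<exists>p. apath u p v \<and> length p = k) \<longleftrightarrow> (\<exists>p. apath v p u \<and> length p = k)" for k
    by (metis apath_rev_path len)
  then show ?thesis unfolding graph_dist_def by simp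
qed

lemma (in pair_wf_digraph) graph_dist_self: "u \<in> pverts G \<Longrightarrow> graph_dist G u u = 0"
  unfolding graph_dist_def by (rule Least_eq_0) (auto simp: apath_Nil_iff)

text \<open>Reachability ensures that the \<open>LEAST\<close> in \<open>graph_dist\<close> is
  attained by a path, and an empty path joins a vertex only to itself.\<close>

lemma (in pair_wf_digraph) graph_dist_pos:
  assumes "u \<rightarrow>\<^sup>*\<^bsub>with_proj G\<^esub> v" and "u \<noteq> v"
  shows "graph_dist G u v > 0"
proof -
  have "\<exists>k p. apath u p v \<and> length p = k" using assms(1) reachable_apath by blast
  then have "\<exists>p. apath u p v \<and> length p = graph_dist G u v"
    unfolding graph_dist_def by (rule LeastI_ex)
  then show ?thesis using assms(2) by (metis apath_Nil_iff gr0I length_0_conv)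
qed

theorem theorem3p3:
  fixes G :: "'n::finite pair_pre_digraph"
  assumes "pair_graph G"
    and "pverts G = UNIV"
    and "Digraph_Component.connected (with_proj G)"
    and "CARD('n) \<ge> 3"
  shows "distance_pareto_rho 1 G - distance_pareto_rho 2 G
    < (MIN u\<in>pverts G. sqrt (\<Sum>v\<in>pverts G. (real (graph_dist G u v))\<^sup>2))"
proof -
  interpret pair_graph G by fact
  let ?D = "distance_matrix G"
  \<comment> \<open>\<open>connected\<close> means strong connectivity of the symmetric closure; the
    arcs of \<open>G\<close> are already symmetric, so reachability is the same.\<close>
  have reach: "u \<rightarrow>\<^sup>*\<^bsub>with_proj G\<^esub> v" for u v
    using assms(2,3) reachable_mk_symmetric_eq[OF pair_sym_arcs]
    by (auto simp: connected_def strongly_connected_def)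
  have sym: "transpose ?D = ?D"
    by (simp add: transpose_def distance_matrix_def vec_eq_iff graph_dist_commute)
  have diag: "?D $ i $ i = 0" for i
    by (simp add: distance_matrix_def graph_dist_self assms(2))
  have pos: "?D $ i $ j > 0" if "i \<noteq> j" for i j
    using graph_dist_pos[OF reach that] by (simp add: distance_matrix_def)
  have "distance_pareto_rho 1 G - distance_pareto_rho 2 G
    < sqrt (\<Sum>v\<in>UNIV. (real (graph_dist G u v))\<^sup>2)" for u
    \<comment> \<open>Symmetry of the distance turns the norm of column \<open>u\<close> into the
      sum over row \<open>u\<close>.\<close>
    using pareto_gap_less_column_norm[OF sym diag pos assms(4), of u]
    by (simp add: distance_pareto_rho_def distance_pareto_eigenvalues_def norm_vec_def L2_set_def
        column_def distance_matrix_def graph_dist_commute[of _ u])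
  then show ?thesis by (simp add: assms(2))
qed

end
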